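(* The random variable $V(-\Gamma_{\widehat P_{n_P},\widehat Q_{n_Q}})$ is measurable and, for every $\delta\in(0,1)$, $$\mathbb P\left(V(-\Gamma_{\widehat P_{n_P},\widehat Q_{n_Q}})+\varepsilon_{n_P,n_Q}(\delta)\le0\ \text{ and }\ Q\not\succeq_{\Phi;k,K;m,M}P\right)\le\delta,$$ where $$\varepsilon_{n_P,n_Q}(\delta):=b\sqrt{\frac{\left(\frac1{n_P}+\frac1{n_Q}\right)\{\log(1/\delta)+(1-k)\log C\}}{2}}.$$
   Context: Let $X$ be a Polish space with Borel $\sigma$-algebra $\mathscr X$ and $(\Theta,\mathscr A)$ a measurable space; $\mathcal P(X)$, $\mathcal P(\Theta)$ are the sets of probability measures. Let $\varphi:X\times\Theta\to\mathbb R$ be $\mathscr X\otimes\mathscr A$-measurable and bounded; write $\varphi_\theta(x):=\varphi(x,\theta)$, $\Phi=(\varphi_\theta)_{\theta\in\Theta}$, and $\Gamma_{P,Q}(\theta):=\mathbb E_Q[\varphi_\theta]-\mathbb E_P[\varphi_\theta]$ for $P,Q\in\mathcal P(X)$. Let $b$ be a uniform range bound: $\sup_{x,x'\in X}|\varphi_\theta(x)-\varphi_\theta(x')|\le b$ for every $\theta\in\Theta$. Let $m,M\in\mathcal P(\Theta)$ and $0\le k<1\le K<\infty$ with $k\,m(B)\le K\,M(B)$ for all $B\in\mathscr A$; $C:=\frac{K-k}{1-k}\ge1$. For finite measures, $\mu\le\nu$ means $\mu(B)\le\nu(B)$ for all measurable $B$. Put $\mathcal P_{k,K;m,M}:=\{\Pi\in\mathcal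 P(\Theta):km\le\Pi\le KM\}$ and, for bounded measurable $G:\Theta\to\mathbb R$, $$V(G):=\sup_{\Pi\in\mathcal P_{k,K;m,M}}\int_\Theta G(\theta)\,\Pi(d\theta).$$ Reference-weighted stochastic dominance (RWSD): $Q\succeq_{\Phi;k,K;m,M}P$ means $\mathbb E_Q[u]\ge\mathbb E_P[u]$ for every $u$ of the form $u(x)=a+\tau\int_\Theta\varphi_\theta(x)\,\Pi(d\theta)$ with $a\in\mathbb R$, $\tau\ge0$, $\Pi\in\mathcal P_{k,K;m,M}$. Samples: fixed $P,Q\in\mathcal P(X)$; $Z_1^P,\ldots,Z_{n_P}^P$ i.i.d. from $P$, $Z_1^Q,\ldots,Z_{n_Q}^Q$ i.i.d. from $Q$, the two samples independent; $\widehat P_{n_P}:=\frac1{n_P}\sum_i\delta_{Z_i^P}$, $\widehat Q_{n_Q}:=\frac1{n_Q}\sum_j\delta_{Z_j^Q}$. The family $\Phi$, the measures $m,M$, and the constants $k,K,b$ are fixed independently of the samples (deterministic). *)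

theory Defs
  imports "HOL-Probability.Probability"
begin

definition Gamma_fun ::
  "('x \<Rightarrow> 'th \<Rightarrow> real) \<Rightarrow> 'x measure \<Rightarrow> 'x measure \<Rightarrow> 'th \<Rightarrow> real" where
  "Gamma_fun \<phi> P Q \<theta> = (\<integral>x. \<phi> x \<theta> \<partial>Q) - (\<integral>x. \<phi> x \<theta> \<partial>P)"

definition ref_class ::
  "'th measure \<Rightarrow> real \<Rightarrow> real \<Rightarrow> 'th measure \<Rightarrow> 'th measure \<Rightarrow> 'th measure set" where
  "ref_class A k K m M = {\<pi> \<in> space (prob_algebra A).
     \<forall>B\<in>sets A. k * measure m B \<le> measure \<pi> B \<and> measure \<pi> B \<le> K * measure M B}"

text \<open>The supremum is taken in the conditionally complete order of the reals; it is the
  true supremum whenever \<open>G\<close> is bounded and measurable and \<open>ref_class\<close> is nonempty, which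
  is the case as soon as \<open>0 \<le> k < 1 \<le> K\<close> and \<open>k m \<le> K M\<close>.\<close>

definition V_fun ::
  "'th measure \<Rightarrow> real \<Rightarrow> real \<Rightarrow> 'th measure \<Rightarrow> 'th measure \<Rightarrow> ('th \<Rightarrow> real) \<Rightarrow> real" where
  "V_fun A k K m M G = (SUP \<pi>\<in>ref_class A k K m M. \<integral>\<theta>. G \<theta> \<partial>\<pi>)"

definition rwsd ::
  "('x \<Rightarrow> 'th \<Rightarrow> real) \<Rightarrow> 'th measure \<Rightarrow> real \<Rightarrow> real \<Rightarrow> 'th measure \<Rightarrow> 'th measure
    \<Rightarrow> 'x measure \<Rightarrow> 'x measure \<Rightarrow> bool" where
  "rwsd \<phi> A k K m M Q P \<longleftrightarrow>
     (\<forall>u. (\<exists>a \<tau> \<pi>. \<tau> \<ge> 0 \<and> \<pi> \<in> ref_class A k K m M \<and> u = (\<lambda>x. a + \<tau> * (\<integral>\<theta>. \<phi> x \<theta> \<partial>\<pi>)))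
          \<longrightarrow> (\<integral>x. u x \<partial>Q) \<ge> (\<integral>x. u x \<partial>P))"

definition empirical :: "nat \<Rightarrow> (nat \<Rightarrow> 'x::topological_space) \<Rightarrow> 'x measure" where
  "empirical n z = measure_of UNIV (sets borel)
     (\<lambda>B. (\<Sum>i<n. emeasure (return borel (z i)) B) / of_nat n)"

lemma sets_empirical [simp, measurable_cong]: "sets (empirical n z) = sets borel"
  unfolding empirical_def by (metis sets.sets_measure_of_eq space_borel)

lemma space_empirical [simp]: "space (empirical n z) = UNIV"
  unfolding empirical_def by (simp add: space_measure_of_conv)

lemma emeasure_empirical:
  assumes B: "B \<in> sets borel"
  shows "emeasure (empirical n z) B = (\<Sum>i<n. emeasure (return borel (z i)) B) / of_nat n"
proof (rule emeasure_measure_of[OF empirical_def])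
  show "sets borel \<subseteq> Pow (UNIV :: 'a set)" by simp
  show "B \<in> sets (empirical n z)" using B by simp
  show "positive (sets (empirical n z))
     (\<lambda>B. (\<Sum>i<n. emeasure (return borel (z i)) B) / of_nat n)"
    by (simp add: positive_def)
  show "countably_additive (sets (empirical n z))
     (\<lambda>B. (\<Sum>i<n. emeasure (return borel (z i)) B) / of_nat n)"
  proof (rule countably_additiveI)
    fix F :: "nat \<Rightarrow> 'a set"
    assume F: "range F \<subseteq> sets (empirical n z)" "disjoint_family F"
    have "(\<Sum>j. emeasure (return borel (z i)) (F j)) = emeasure (return borel (z i)) (\<Union>j. F j)" for i
      by (rule suminf_emeasure) (use F in auto)
    then show "(\<Sum>j. (\<Sum>i<n. emeasure (return borel (z i)) (F j)) / of_nat n)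
        = (\<Sum>i<n. emeasure (return borel (z i)) (\<Union>j. F j)) / of_nat n"
      by (simp add: suminf_sum divide_ennreal_def)
  qed
qed

definition C_const :: "real \<Rightarrow> real \<Rightarrow> real" where
  "C_const k K = (K - k) / (1 - k)"

definition eps_bound :: "real \<Rightarrow> real \<Rightarrow> real \<Rightarrow> nat \<Rightarrow> nat \<Rightarrow> real \<Rightarrow> real" where
  "eps_bound b k K nP nQ \<delta> =
     b * sqrt ((1 / real nP + 1 / real nQ) * (ln (1 / \<delta>) + (1 - k) * ln (C_const k K)) / 2)"

end

theory Submission imports Defs begin

text \<open>
  If dominance fails, then it fails for one deterministic weight \<open>\<pi>\<close>, that is, for the single bounded
  function \<open>f x = \<integral> \<phi> x \<theta> d\<pi>\<close>. The event \<open>V + \<epsilon> \<le> 0\<close> then forces the empirical means of \<open>f\<close> to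
  deviate from their expectations by at least \<open>\<epsilon>\<close>, and Hoeffding's inequality for the two samples
  applies to this one function without any union bound.

  Measurability of the supremum comes from linear programming duality:
  \<open>V G = inf\<^sub>t (t + K \<integral> (G - t)\<^sup>+ dM - k \<integral> (t - G)\<^sup>+ dm)\<close>, where the infimum may be restricted to
  rational \<open>t\<close>. The optimal weight is \<open>K M\<close> above a quantile of \<open>G\<close>, \<open>k m\<close> below it, and a mixture
  of the two on the level set.
\<close>

section \<open>Duality for the supremum over the reference class\<close>

text \<open>Domination on every set is the order of the two scaled measures, and integrals of
  nonnegative functions respect that order. A constant on each side lets the same fact serve for
  \<open>\<pi> \<le> K M\<close>, \<open>k m \<le> \<pi>\<close> and
  \<open>k m \<le> K M\<close>.\<close>

lemma scaled_integral_mono: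
  fixes f :: "'a \<Rightarrow> real"
  assumes "finite_measure N1" "finite_measure N2" and sets: "sets N1 = sets N2"
    and c: "0 \<le> c1" "0 \<le> c2"
    and le: "\<And>B. B \<in> sets N1 \<Longrightarrow> c1 * measure N1 B \<le> c2 * measure N2 B"
    and int: "integrable N1 f" "integrable N2 f" and nonneg: "\<And>x. 0 \<le> f x"
  shows "c1 * (\<integral>x. f x \<partial>N1) \<le> c2 * (\<integral>x. f x \<partial>N2)"
proof -
  interpret N1: finite_measure N1 by fact
  interpret N2: finite_measure N2 by fact
  have scaled: "ennreal (c * (\<integral>x. f x \<partial>N)) = (\<integral>\<^sup>+x. f x \<partial>scale_measure c N)"
    if "integrable N f" "0 \<le> c" for c N
    using that nonneg
    by (simp add: nn_integral_scale_measure nn_integral_eq_integral ennreal_mult integral_nonneg)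
  have le': "emeasure (scale_measure c1 N1) B \<le> emeasure (scale_measure c2 N2) B" for B
  proof (cases "B \<in> sets N1")
    case True
    then show ?thesis
      using le[OF True] c
      by (simp add: N1.emeasure_eq_measure N2.emeasure_eq_measure flip: ennreal_mult)
  next
    \<comment> \<open>Off the common sigma-algebra both sides take the default value 0 of
      \<open>emeasure\<close>.\<close>
    case False
    then show ?thesis using sets by (simp add: emeasure_notin_sets)
  qed
  have "scale_measure c1 N1 \<le> scale_measure c2 N2"
    using sets le' sets_eq_imp_space_eq[OF sets]
    by (auto simp: le_measure_iff space_scale_measure le_fun_def)
  then have "ennreal (c1 * (\<integral>x. f x \<partial>N1)) \<le> ennreal (c2 * (\<integral>x. f x \<partial>N2))"
    using int c sets by (simp only: scaled) (rule nn_integral_mono_measure, simp_all)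
  then show ?thesis
    using c nonneg by (subst (asm) ennreal_le_iff) (auto intro!: mult_nonneg_nonneg integral_nonneg)
qed

lemma integrable_bounded_on_space:
  fixes f :: "'a \<Rightarrow> real"
  assumes "finite_measure N" "f \<in> borel_measurable N" "\<And>x. x \<in> space N \<Longrightarrow> \<bar>f x\<bar> \<le> c"
  shows "integrable N f"
  using assms by (intro finite_measure.integrable_const_bound[where B = c]) auto

text \<open>The objective of the dual of the linear program defining \<^const>\<open>V_fun\<close>, whose multiplier
  \<open>t\<close> belongs to the constraint that the weight has total mass one.\<close>

definition dual_objective ::
  "real \<Rightarrow> real \<Rightarrow> 'th measure \<Rightarrow> 'th measure \<Rightarrow> ('th \<Rightarrow> real) \<Rightarrow> real \<Rightarrow> real" where
  "dual_objective k K m M G t =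
     t + K * (\<integral>\<theta>. max 0 (G \<theta> - t) \<partial>M) - k * (\<integral>\<theta>. max 0 (t - G \<theta>) \<partial>m)"

section \<open>Weak duality, the optimal weight and measurability of the value\<close>

locale reference_weights =
  fixes A :: "'th measure" and k K :: real and m M :: "'th measure"
  assumes m: "m \<in> space (prob_algebra A)"
    and M: "M \<in> space (prob_algebra A)"
    and k: "0 \<le> k" "k < 1"
    and K: "1 \<le> K"
    and kK: "\<And>B. B \<in> sets A \<Longrightarrow> k * measure m B \<le> K * measure M B"
begin

sublocale m: prob_space m
  using m by (simp add: space_prob_algebra)

sublocale M: prob_space M
  using M by (simp add: space_prob_algebra)

lemma sets_m [simp, measurable_cong]: "sets m = sets A"
  and sets_M [simp, measurable_cong]: "sets M = sets A"
  using m M by (simp_all add: space_prob_algebra)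

lemma space_m [simp]: "space m = space A" and space_M [simp]: "space M = space A"
  by (simp_all cong: sets_eq_imp_space_eq)

text \<open>Weak duality. In \<open>G = t + (G - t)^+ - (t - G)^+\<close> the constant integrates to
  itself because \<pi> has mass one, the positive part is controlled by
  \<open>\<pi> \<le> K M\<close> and the negative part by \<open>k m \<le> \<pi>\<close>.\<close>

lemma integral_le_dual_objective:
  fixes G :: "'th \<Rightarrow> real"
  assumes \<pi>: "\<pi> \<in> ref_class A k K m M"
    and G [measurable]: "G \<in> borel_measurable A"
    and bound: "\<And>\<theta>. \<theta> \<in> space A \<Longrightarrow> \<bar>G \<theta>\<bar> \<le> c"
  shows "(\<integral>\<theta>. G \<theta> \<partial>\<pi>) \<le> dual_objective k K m M G t"
proof -
  have [measurable_cong, simp]: "sets \<pi> = sets A" and "prob_space \<pi>"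
    using \<pi> by (simp_all add: ref_class_def space_prob_algebra)
  then interpret \<pi>: prob_space \<pi> by simp
  have [simp]: "space \<pi> = space A" by (rule sets_eq_imp_space_eq) simp
  have pos: "integrable N (\<lambda>\<theta>. max 0 (G \<theta> - t))" and neg: "integrable N (\<lambda>\<theta>. max 0 (t - G \<theta>))"
    if "prob_space N" and [measurable_cong]: "sets N = sets A" for N
  proof -
    interpret N: prob_space N by fact
    have "space N = space A" using that(2) by (rule sets_eq_imp_space_eq)
    then have "\<bar>G \<theta>\<bar> \<le> c" if "\<theta> \<in> space N" for \<theta> using bound that by simp
    then show "integrable N (\<lambda>\<theta>. max 0 (G \<theta> - t))" "integrable N (\<lambda>\<theta>. max 0 (t - G \<theta>))"
      by (intro integrable_bounded_on_space[where c = "c + \<bar>t\<bar>"] N.finite_measure_axioms;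
          force)+
  qed
  have "(\<integral>\<theta>. G \<theta> \<partial>\<pi>) = (\<integral>\<theta>. t + (max 0 (G \<theta> - t) - max 0 (t - G \<theta>)) \<partial>\<pi>)"
    by (rule Bochner_Integration.integral_cong) auto
  also have "\<dots> = t + ((\<integral>\<theta>. max 0 (G \<theta> - t) \<partial>\<pi>) - (\<integral>\<theta>. max 0 (t - G \<theta>) \<partial>\<pi>))"
    using pos[OF \<pi>.prob_space_axioms] neg[OF \<pi>.prob_space_axioms] by (simp add: \<pi>.prob_space[simplified])
  finally have eq: "(\<integral>\<theta>. G \<theta> \<partial>\<pi>) =
    t + ((\<integral>\<theta>. max 0 (G \<theta> - t) \<partial>\<pi>) - (\<integral>\<theta>. max 0 (t - G \<theta>) \<partial>\<pi>))" .
  have "1 * (\<integral>\<theta>. max 0 (G \<theta> - t) \<partial>\<pi>) \<le> K * (\<integral>\<theta>. max 0 (G \<theta> - t) \<partial>M)"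
    using \<pi> K by (intro scaled_integral_mono \<pi>.finite_measure_axioms M.finite_measure_axioms pos
        \<pi>.prob_space_axioms M.prob_space_axioms) (auto simp: ref_class_def)
  moreover have "k * (\<integral>\<theta>. max 0 (t - G \<theta>) \<partial>m) \<le> 1 * (\<integral>\<theta>. max 0 (t - G \<theta>) \<partial>\<pi>)"
    using \<pi> k by (intro scaled_integral_mono \<pi>.finite_measure_axioms m.finite_measure_axioms neg
        \<pi>.prob_space_axioms m.prob_space_axioms) (auto simp: ref_class_def)
  ultimately show ?thesis
    by (simp add: eq dual_objective_def)
qed

text \<open>The measure sought is \<open>h K M + (1 - h) k m\<close>, where \<open>h\<close> is the
  share given to the upper constraint at each point. As \<open>k m \<le> K M\<close> makes
  \<open>k m\<close> absolutely continuous with respect to \<open>M\<close>, this mixture is a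
  single density over \<open>M\<close>. Its total mass depends on \<open>h\<close> and becomes one
  only through the later choice of \<open>h\<close>.\<close>

lemma weighted_mixture_exists:
  fixes h :: "'th \<Rightarrow> real"
  assumes h [measurable]: "h \<in> borel_measurable A"
    and h01: "\<And>\<theta>. 0 \<le> h \<theta>" "\<And>\<theta>. h \<theta> \<le> 1"
  obtains \<pi> where "sets \<pi> = sets A" "finite_measure \<pi>"
    "\<And>f c. f \<in> borel_measurable A \<Longrightarrow> (\<And>\<theta>. 0 \<le> f \<theta>) \<Longrightarrow> (\<And>\<theta>. \<theta> \<in> space A \<Longrightarrow> f \<theta> \<le> c) \<Longrightarrow>
      (\<integral>\<theta>. f \<theta> \<partial>\<pi>) = K * (\<integral>\<theta>. h \<theta> * f \<theta> \<partial>M) + k * (\<integral>\<theta>. (1 - h \<theta>) * f \<theta> \<partial>m)"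
proof -
  have "absolutely_continuous M (scale_measure k m)"
    unfolding absolutely_continuous_def
  proof (rule subsetI)
    fix B assume B: "B \<in> null_sets M"
    then have "B \<in> sets A" "measure M B = 0"
      by (auto simp: null_sets_def measure_def)
    with kK[of B] have "k * measure m B = 0"
      using mult_nonneg_nonneg[OF k(1) measure_nonneg[of m B]] by auto
    with \<open>B \<in> sets A\<close> k show "B \<in> null_sets (scale_measure k m)"
      by (auto simp: null_sets_def m.emeasure_eq_measure simp flip: ennreal_mult)
  qed
  then obtain g where [measurable]: "g \<in> borel_measurable M" and g: "density M g = scale_measure k m"
    using M.Radon_Nikodym[of "scale_measure k m"] by auto
  \<comment> \<open>\<open>g\<close> is the density of \<open>k m\<close>, so the factor
    \<open>k\<close> is already contained in it.\<close>
  define \<pi> where "\<pi> = density M (\<lambda>\<theta>. ennreal K * ennreal (h \<theta>) + ennreal (1 - h \<theta>) * g \<theta>)"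
  have sets_\<pi> [simp, measurable_cong]: "sets \<pi> = sets A"
    by (simp add: \<pi>_def)
  have nn: "(\<integral>\<^sup>+\<theta>. f \<theta> \<partial>\<pi>) = ennreal K * (\<integral>\<^sup>+\<theta>. ennreal (h \<theta>) * f \<theta> \<partial>M)
      + ennreal k * (\<integral>\<^sup>+\<theta>. ennreal (1 - h \<theta>) * f \<theta> \<partial>m)"
    if [measurable]: "f \<in> borel_measurable A" for f
  proof -
    have "(\<integral>\<^sup>+\<theta>. f \<theta> \<partial>\<pi>) = (\<integral>\<^sup>+\<theta>. ennreal K * (ennreal (h \<theta>) * f \<theta>)
        + g \<theta> * (ennreal (1 - h \<theta>) * f \<theta>) \<partial>M)"
      unfolding \<pi>_def by (subst nn_integral_density) (auto simp: algebra_simps intro!: nn_integral_cong)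
    also have "\<dots> = ennreal K * (\<integral>\<^sup>+\<theta>. ennreal (h \<theta>) * f \<theta> \<partial>M)
        + (\<integral>\<^sup>+\<theta>. ennreal (1 - h \<theta>) * f \<theta> \<partial>density M g)"
      by (simp add: nn_integral_add nn_integral_cmult nn_integral_density)
    finally show ?thesis
      unfolding g by (simp add: nn_integral_scale_measure)
  qed
  have real: "(\<integral>\<^sup>+\<theta>. ennreal (f \<theta>) \<partial>\<pi>) =
      ennreal (K * (\<integral>\<theta>. h \<theta> * f \<theta> \<partial>M) + k * (\<integral>\<theta>. (1 - h \<theta>) * f \<theta> \<partial>m))"
    if [measurable]: "f \<in> borel_measurable A" and f: "\<And>\<theta>. 0 \<le> f \<theta>" "\<And>\<theta>. \<theta> \<in> space A \<Longrightarrow> f \<theta> \<le> c"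
    for f c
  proof -
    have "\<bar>h \<theta> * f \<theta>\<bar> \<le> 1 * c" "\<bar>(1 - h \<theta>) * f \<theta>\<bar> \<le> 1 * c" if "\<theta> \<in> space A" for \<theta>
      unfolding abs_mult using that f h01[of \<theta>] by (intro mult_mono; force)+
    then have int: "integrable M (\<lambda>\<theta>. h \<theta> * f \<theta>)" "integrable m (\<lambda>\<theta>. (1 - h \<theta>) * f \<theta>)"
      by (auto intro!: integrable_bounded_on_space[where c = "1 * c"]
          m.finite_measure_axioms M.finite_measure_axioms)
    have "(\<integral>\<^sup>+\<theta>. ennreal (f \<theta>) \<partial>\<pi>) = ennreal K * (\<integral>\<^sup>+\<theta>. ennreal (h \<theta> * f \<theta>) \<partial>M)
        + ennreal k * (\<integral>\<^sup>+\<theta>. ennreal ((1 - h \<theta>) * f \<theta>) \<partial>m)"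
      using h01 f by (subst nn) (simp_all add: ennreal_mult)
    also have "\<dots> = ennreal K * ennreal (\<integral>\<theta>. h \<theta> * f \<theta> \<partial>M)
        + ennreal k * ennreal (\<integral>\<theta>. (1 - h \<theta>) * f \<theta> \<partial>m)"
      using h01 f int by (simp add: nn_integral_eq_integral)
    also have "\<dots> = ennreal (K * (\<integral>\<theta>. h \<theta> * f \<theta> \<partial>M) + k * (\<integral>\<theta>. (1 - h \<theta>) * f \<theta> \<partial>m))"
      using h01 f k K by (simp add: integral_nonneg ennreal_mult ennreal_plus)
    finally show ?thesis .
  qed
  show ?thesis
  proof
    show "finite_measure \<pi>"
      using real[of "\<lambda>_. 1" 1] by (intro finite_measureI) simp
    fix f :: "'th \<Rightarrow> real" and c
    assume f [measurable]: "f \<in> borel_measurable A" and nonneg: "\<And>\<theta>. 0 \<le> f \<theta>"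
      and le: "\<And>\<theta>. \<theta> \<in> space A \<Longrightarrow> f \<theta> \<le> c"
    have "(\<integral>\<theta>. f \<theta> \<partial>\<pi>) = enn2real (\<integral>\<^sup>+\<theta>. ennreal (f \<theta>) \<partial>\<pi>)"
      using nonneg by (intro integral_eq_nn_integral) auto
    also have "(\<integral>\<^sup>+\<theta>. ennreal (f \<theta>) \<partial>\<pi>) =
        ennreal (K * (\<integral>\<theta>. h \<theta> * f \<theta> \<partial>M) + k * (\<integral>\<theta>. (1 - h \<theta>) * f \<theta> \<partial>m))"
      using f nonneg le by (rule real)
    also have "enn2real \<dots> = K * (\<integral>\<theta>. h \<theta> * f \<theta> \<partial>M) + k * (\<integral>\<theta>. (1 - h \<theta>) * f \<theta> \<partial>m)"
      using h01 nonneg k K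
      by (intro enn2real_ennreal add_nonneg_nonneg mult_nonneg_nonneg integral_nonneg) auto
    finally show "(\<integral>\<theta>. f \<theta> \<partial>\<pi>) = K * (\<integral>\<theta>. h \<theta> * f \<theta> \<partial>M) + k * (\<integral>\<theta>. (1 - h \<theta>) * f \<theta> \<partial>m)" .
  qed simp
qed

text \<open>The \<open>(1 - k) / (K - k)\<close> upper quantile of \<open>G\<close> under the measure \<open>K M - k m\<close>.\<close>

lemma quantile_exists:
  fixes G :: "'th \<Rightarrow> real"
  assumes G [measurable]: "G \<in> borel_measurable A"
    and bound: "\<And>\<theta>. \<theta> \<in> space A \<Longrightarrow> \<bar>G \<theta>\<bar> \<le> c"
  obtains t where
    "K * measure M {\<theta>\<in>space A. t < G \<theta>} + k * measure m {\<theta>\<in>space A. G \<theta> \<le> t} \<le> 1"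
    "1 \<le> K * measure M {\<theta>\<in>space A. t \<le> G \<theta>} + k * measure m {\<theta>\<in>space A. G \<theta> < t}"
proof -
  let ?M = "distr M borel G" and ?m = "distr m borel G"
  interpret M': real_distribution ?M by (rule M.real_distribution_distr) simp
  interpret m': real_distribution ?m by (rule m.real_distribution_distr) simp
  \<comment> \<open>\<open>F t\<close> is the mass of the weight that equals \<open>K M\<close>
    where \<open>G > t\<close> and \<open>k m\<close> where \<open>G \<le> t\<close>. The two claims
    say that \<open>F t\<close> is at most 1 and the left limit of \<open>F\<close> at
    \<open>t\<close> is at least 1.\<close>
  define F where "F t = K * (1 - cdf ?M t) + k * cdf ?m t" for t
  have cdf_M: "cdf ?M t = measure M {\<theta>\<in>space A. G \<theta> \<le> t}" for t
    by (auto simp: cdf_def measure_distr vimage_def intro!: arg_cong[where f = "measure M"])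
  have cdf_m: "cdf ?m t = measure m {\<theta>\<in>space A. G \<theta> \<le> t}" for t
    by (auto simp: cdf_def measure_distr vimage_def intro!: arg_cong[where f = "measure m"])
  have lt: "measure (distr N borel G) {..<t} = measure N {\<theta>\<in>space A. G \<theta> < t}"
    if [measurable_cong]: "sets N = sets A" for N t
    using sets_eq_imp_space_eq[OF that]
    by (auto simp: measure_distr vimage_def intro!: arg_cong[where f = "measure N"])
  have compl_le: "1 - measure M {\<theta>\<in>space A. G \<theta> \<le> t} = measure M {\<theta>\<in>space A. t < G \<theta>}" for t
    by (subst M.prob_compl[symmetric]) (auto intro!: arg_cong[where f = "measure M"])
  have compl_less: "1 - measure M {\<theta>\<in>space A. G \<theta> < t} = measure M {\<theta>\<in>space A. t \<le> G \<theta>}" for t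
    by (subst M.prob_compl[symmetric]) (auto intro!: arg_cong[where f = "measure M"])
  have "F c \<le> 1"
  proof -
    have "{\<theta>\<in>space A. G \<theta> \<le> c} = space A"
      using bound by (auto simp: abs_le_iff)
    then have "cdf ?M c = 1" "cdf ?m c = 1"
      using M.prob_space m.prob_space by (simp_all add: cdf_M cdf_m)
    then show ?thesis using k by (simp add: F_def)
  qed
  have F_antimono: "F t \<le> F s" if "s \<le> t" for s t
  proof -
    \<comment> \<open>The drop \<open>F s - F t\<close> is the mass that \<open>K M - k m\<close>
      gives to the points with \<open>s < G \<le> t\<close>.\<close>
    have "k * (measure m {\<theta>\<in>space A. s < G \<theta> \<and> G \<theta> \<le> t}) \<le>
        K * (measure M {\<theta>\<in>space A. s < G \<theta> \<and> G \<theta> \<le> t})"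
      by (rule kK) simp
    moreover have "measure N {\<theta>\<in>space A. s < G \<theta> \<and> G \<theta> \<le> t} =
        measure N {\<theta>\<in>space A. G \<theta> \<le> t} - measure N {\<theta>\<in>space A. G \<theta> \<le> s}"
      if "finite_measure N" "sets N = sets A" for N
      using \<open>s \<le> t\<close> that
      by (subst finite_measure.finite_measure_Diff[symmetric])
        (auto intro!: arg_cong[where f = "measure N"])
    ultimately show ?thesis
      by (simp add: F_def cdf_M cdf_m m.finite_measure_axioms M.finite_measure_axioms algebra_simps)
  qed
  \<comment> \<open>The cutoff \<open>- c\<close> keeps the set bounded below also for
    \<open>K = 1\<close>, where \<open>F \<le> 1\<close> everywhere.\<close>
  define S where "S = {t. - c \<le> t \<and> F t \<le> 1}"
  have "0 \<le> c"
    using bound M.not_empty by fastforce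
  then have "c \<in> S"
    using \<open>F c \<le> 1\<close> by (simp add: S_def)
  have "bdd_below S" by (auto simp: S_def)
  define t where "t = Inf S"
  have t: "- c \<le> t"
    unfolding t_def using \<open>c \<in> S\<close> by (intro cInf_greatest) (blast, simp add: S_def)
  \<comment> \<open>Right continuity carries \<open>F \<le> 1\<close> from the points beyond the
    infimum to the infimum itself.\<close>
  have "(F \<longlongrightarrow> F t) (at_right t)"
    using M'.cdf_is_right_cont[of t] m'.cdf_is_right_cont[of t]
    unfolding F_def continuous_within by (intro tendsto_intros)
  moreover have "F s \<le> 1" if "t < s" for s
  proof -
    obtain r where "r \<in> S" "r < s"
      using cInf_lessD[of S s] \<open>c \<in> S\<close> \<open>t < s\<close> by (auto simp: t_def)
    then show ?thesis using F_antimono[of r s] by (auto simp: S_def)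
  qed
  ultimately have "F t \<le> 1"
    by (intro tendsto_upperbound[of F "F t" "at_right t"]) (auto simp: eventually_at_filter)
  moreover have "1 \<le> K * (1 - measure ?M {..<t}) + k * measure ?m {..<t}"
  proof (cases "t = - c")
    case True
    \<comment> \<open>No value of \<open>G\<close> lies below the cutoff, so the left limit is
      \<open>K\<close>.\<close>
    have empty: "{\<theta>\<in>space A. G \<theta> < t} = {}"
      using bound True by (force simp: abs_le_iff)
    show ?thesis
      using K by (simp add: lt empty)
  next
    case False
    \<comment> \<open>Such an \<open>s\<close> is above the cutoff but below \<open>Inf S\<close>,
      so it can only be missing from \<open>S\<close> because \<open>F s > 1\<close>.\<close>
    have "1 \<le> F s" if "- c < s" "s < t" for s
      using cInf_lower[OF _ \<open>bdd_below S\<close>, of s] that by (force simp: t_def S_def)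
    then have "\<forall>\<^sub>F s in at_left t. 1 \<le> F s"
      using t False by (intro eventually_at_leftI[of "- c"]) auto
    moreover have "(F \<longlongrightarrow> K * (1 - measure ?M {..<t}) + k * measure ?m {..<t}) (at_left t)"
      unfolding F_def by (intro tendsto_intros M'.cdf_at_left m'.cdf_at_left)
    ultimately show ?thesis
      by (intro tendsto_lowerbound) auto
  qed
  ultimately show ?thesis
    by (intro that[of t])
      (simp_all add: F_def cdf_M cdf_m lt flip: compl_le compl_less)
qed


text \<open>Complementary slackness: a weight equal to \<open>K M\<close> above the quantile
  \<open>t\<close> and to \<open>k m\<close> below it turns both estimates of weak duality into
  equalities. On the level set \<open>G = t\<close> both parts of \<open>G - t\<close> vanish, so
  the split there is free and can be used to make the total mass one.\<close>

lemma dual_objective_attained: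
  fixes G :: "'th \<Rightarrow> real"
  assumes G [measurable]: "G \<in> borel_measurable A"
    and bound: "\<And>\<theta>. \<theta> \<in> space A \<Longrightarrow> \<bar>G \<theta>\<bar> \<le> c"
  obtains t \<pi> where "\<pi> \<in> ref_class A k K m M" "(\<integral>\<theta>. G \<theta> \<partial>\<pi>) = dual_objective k K m M G t"
proof -
  obtain t where
    t: "K * measure M {\<theta>\<in>space A. t < G \<theta>} + k * measure m {\<theta>\<in>space A. G \<theta> \<le> t} \<le> 1" (is "?lo \<le> 1")
      "1 \<le> K * measure M {\<theta>\<in>space A. t \<le> G \<theta>} + k * measure m {\<theta>\<in>space A. G \<theta> < t}" (is "1 \<le> ?hi")
    using quantile_exists[OF G bound] by blast
  \<comment> \<open>The masses \<open>?lo\<close> and \<open>?hi\<close> differ only in whether the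
    level set carries \<open>k m\<close> or \<open>K M\<close>.\<close>
  have "?hi - ?lo = K * measure M {\<theta>\<in>space A. G \<theta> = t} - k * measure m {\<theta>\<in>space A. G \<theta> = t}"
  proof -
    have "{\<theta>\<in>space A. t \<le> G \<theta>} = {\<theta>\<in>space A. t < G \<theta>} \<union> {\<theta>\<in>space A. G \<theta> = t}"
      "{\<theta>\<in>space A. G \<theta> \<le> t} = {\<theta>\<in>space A. G \<theta> < t} \<union> {\<theta>\<in>space A. G \<theta> = t}"
      by auto
    then show ?thesis
      by (simp add: M.finite_measure_Union m.finite_measure_Union disjoint_iff algebra_simps)
  qed
  \<comment> \<open>\<open>l\<close> solves \<open>?lo + l * (?hi - ?lo) = 1\<close>. If the two
    masses coincide, both are 1 and any value in \<open>[0, 1]\<close> would do.\<close>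
  define l where "l = (if ?hi = ?lo then 0 else (1 - ?lo) / (?hi - ?lo))"
  have l: "0 \<le> l" "l \<le> 1" "?lo + l * (?hi - ?lo) = 1"
    using t by (auto simp: l_def divide_simps)
  define h :: "'th \<Rightarrow> real" where
    "h \<theta> = indicator {\<theta>\<in>space A. t < G \<theta>} \<theta> + l * indicator {\<theta>\<in>space A. G \<theta> = t} \<theta>" for \<theta>
  have [measurable]: "h \<in> borel_measurable A" unfolding h_def by simp
  have h01: "0 \<le> h \<theta>" "h \<theta> \<le> 1" for \<theta>
    using l by (auto simp: h_def indicator_def)
  obtain \<pi> where sets_\<pi> [simp, measurable_cong]: "sets \<pi> = sets A" and fin: "finite_measure \<pi>"
    and \<pi>: "\<And>f c. f \<in> borel_measurable A \<Longrightarrow> (\<And>\<theta>. 0 \<le> f \<theta>) \<Longrightarrow> (\<And>\<theta>. \<theta> \<in> space A \<Longrightarrow> f \<theta> \<le> c) \<Longrightarrow>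
      (\<integral>\<theta>. f \<theta> \<partial>\<pi>) = K * (\<integral>\<theta>. h \<theta> * f \<theta> \<partial>M) + k * (\<integral>\<theta>. (1 - h \<theta>) * f \<theta> \<partial>m)"
    using weighted_mixture_exists[OF \<open>h \<in> borel_measurable A\<close> h01] by blast
  interpret \<pi>: finite_measure \<pi> by fact
  have space_\<pi> [simp]: "space \<pi> = space A" by (rule sets_eq_imp_space_eq) simp
  have measure_\<pi>: "measure \<pi> B = K * (\<integral>\<theta>. h \<theta> * indicator B \<theta> \<partial>M)
      + k * (\<integral>\<theta>. (1 - h \<theta>) * indicator B \<theta> \<partial>m)" if [measurable]: "B \<in> sets A" for B
    using \<pi>[of "indicator B" 1] that sets.sets_into_space[OF that]
    by (simp add: Int_absorb2)
  have "measure \<pi> (space A) = 1"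
  proof -
    have "(\<integral>\<theta>. h \<theta> * indicator (space A) \<theta> \<partial>M) =
        (\<integral>\<theta>. indicator {\<theta>\<in>space A. t < G \<theta>} \<theta> + l * indicator {\<theta>\<in>space A. G \<theta> = t} \<theta> \<partial>M)"
      by (rule Bochner_Integration.integral_cong) (auto simp: h_def)
    also have "\<dots> = measure M {\<theta>\<in>space A. t < G \<theta>} + l * measure M {\<theta>\<in>space A. G \<theta> = t}"
      by (subst Bochner_Integration.integral_add)
        (auto simp: Int_def conj_commute intro!: M.integrable_const_bound[where B = 1] cong: conj_cong)
    finally have 1: "(\<integral>\<theta>. h \<theta> * indicator (space A) \<theta> \<partial>M) = \<dots>" .
    have "(\<integral>\<theta>. (1 - h \<theta>) * indicator (space A) \<theta> \<partial>m) =
        (\<integral>\<theta>. indicator {\<theta>\<in>space A. G \<theta> \<le> t} \<theta> - l * indicator {\<theta>\<in>space A. G \<theta> = t} \<theta> \<partial>m)"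
      by (rule Bochner_Integration.integral_cong) (auto simp: h_def indicator_def)
    also have "\<dots> = measure m {\<theta>\<in>space A. G \<theta> \<le> t} - l * measure m {\<theta>\<in>space A. G \<theta> = t}"
      by (subst Bochner_Integration.integral_diff)
        (auto simp: Int_def conj_commute intro!: m.integrable_const_bound[where B = 1] cong: conj_cong)
    finally have 2: "(\<integral>\<theta>. (1 - h \<theta>) * indicator (space A) \<theta> \<partial>m) = \<dots>" .
    show ?thesis
      using l(3) unfolding measure_\<pi>[OF sets.top] 1 2
        \<open>?hi - ?lo = K * measure M {\<theta>\<in>space A. G \<theta> = t} - k * measure m {\<theta>\<in>space A. G \<theta> = t}\<close>
      by (simp add: algebra_simps)
  qed
  then have prob: "prob_space \<pi>"
    by (intro prob_spaceI) (simp add: \<pi>.emeasure_eq_measure)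
  \<comment> \<open>For the mixture, \<open>\<pi> - k m\<close> is \<open>h (K M - k m)\<close> and
    \<open>K M - \<pi>\<close> is \<open>(1 - h) (K M - k m)\<close>. The cases \<open>w = h\<close>
    and \<open>w = 1 - h\<close> therefore give the lower and the upper constraint.\<close>
  have weighted_mono: "k * (\<integral>\<theta>. w \<theta> * indicator B \<theta> \<partial>m) \<le> K * (\<integral>\<theta>. w \<theta> * indicator B \<theta> \<partial>M)"
    if [measurable]: "w \<in> borel_measurable A" "B \<in> sets A" and w: "\<And>\<theta>. 0 \<le> w \<theta>" "\<And>\<theta>. w \<theta> \<le> 1"
    for w :: "'th \<Rightarrow> real" and B
    using k K kK w
    by (intro scaled_integral_mono integrable_bounded_on_space[where c = 1]
        m.finite_measure_axioms M.finite_measure_axioms) (auto simp: indicator_def)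
  have split: "measure N B = (\<integral>\<theta>. h \<theta> * indicator B \<theta> \<partial>N) + (\<integral>\<theta>. (1 - h \<theta>) * indicator B \<theta> \<partial>N)"
    if "finite_measure N" and [measurable_cong]: "sets N = sets A" and [measurable]: "B \<in> sets A" for N B
  proof -
    interpret N: finite_measure N by fact
    have [simp]: "space N = space A" by (rule sets_eq_imp_space_eq) fact
    have int: "integrable N (\<lambda>\<theta>. h \<theta> * indicator B \<theta>)" "integrable N (\<lambda>\<theta>. (1 - h \<theta>) * indicator B \<theta>)"
      using h01 by (auto intro!: integrable_bounded_on_space[where c = 1] N.finite_measure_axioms
          simp: indicator_def)
    have "measure N B = (\<integral>\<theta>. indicator B \<theta> \<partial>N)"
      using sets.sets_into_space[OF \<open>B \<in> sets A\<close>] by (simp add: Int_absorb2)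
    also have "\<dots> = (\<integral>\<theta>. h \<theta> * indicator B \<theta> + (1 - h \<theta>) * indicator B \<theta> \<partial>N)"
      by (simp add: algebra_simps)
    finally show ?thesis using int by simp
  qed
  have "\<pi> \<in> ref_class A k K m M"
    unfolding ref_class_def
  proof (intro CollectI conjI ballI)
    show "\<pi> \<in> space (prob_algebra A)"
      using prob by (simp add: space_prob_algebra)
    fix B assume B: "B \<in> sets A"
    show "k * measure m B \<le> measure \<pi> B"
      using weighted_mono[OF _ B, of h] h01
      unfolding measure_\<pi>[OF B] split[OF m.finite_measure_axioms sets_m B]
      by (simp add: distrib_left)
    show "measure \<pi> B \<le> K * measure M B"
      using weighted_mono[OF _ B, of "\<lambda>\<theta>. 1 - h \<theta>"] h01
      unfolding measure_\<pi>[OF B] split[OF M.finite_measure_axioms sets_M B]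
      by (simp add: distrib_left)
  qed
  moreover have "(\<integral>\<theta>. G \<theta> \<partial>\<pi>) = dual_objective k K m M G t"
  proof -
    interpret p: prob_space \<pi> by fact
    have int: "integrable \<pi> (\<lambda>\<theta>. max 0 (G \<theta> - t))" "integrable \<pi> (\<lambda>\<theta>. max 0 (t - G \<theta>))"
      using bound by (intro integrable_bounded_on_space[where c = "c + \<bar>t\<bar>"] fin; force)+
    have "(\<integral>\<theta>. G \<theta> \<partial>\<pi>) = (\<integral>\<theta>. t + (max 0 (G \<theta> - t) - max 0 (t - G \<theta>)) \<partial>\<pi>)"
      by (rule Bochner_Integration.integral_cong) auto
    also have "\<dots> = t + ((\<integral>\<theta>. max 0 (G \<theta> - t) \<partial>\<pi>) - (\<integral>\<theta>. max 0 (t - G \<theta>) \<partial>\<pi>))"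
      using int p.prob_space by simp
    also have "(\<integral>\<theta>. max 0 (G \<theta> - t) \<partial>\<pi>) =
        K * (\<integral>\<theta>. h \<theta> * max 0 (G \<theta> - t) \<partial>M) + k * (\<integral>\<theta>. (1 - h \<theta>) * max 0 (G \<theta> - t) \<partial>m)"
      using bound by (intro \<pi>[of _ "c + \<bar>t\<bar>"]) force+
    \<comment> \<open>Here and below, \<open>h\<close> is 1 where \<open>G > t\<close> and 0 where
      \<open>G < t\<close>, so each part of \<open>G - t\<close> meets only one of the two reference
      measures.\<close>
    also have "(\<integral>\<theta>. h \<theta> * max 0 (G \<theta> - t) \<partial>M) = (\<integral>\<theta>. max 0 (G \<theta> - t) \<partial>M)"
      by (rule Bochner_Integration.integral_cong) (auto simp: h_def indicator_def)
    also have "(\<integral>\<theta>. (1 - h \<theta>) * max 0 (G \<theta> - t) \<partial>m) = (\<integral>\<theta>. 0 \<partial>m)"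
      by (rule Bochner_Integration.integral_cong) (auto simp: h_def indicator_def)
    also have "(\<integral>\<theta>. max 0 (t - G \<theta>) \<partial>\<pi>) =
        K * (\<integral>\<theta>. h \<theta> * max 0 (t - G \<theta>) \<partial>M) + k * (\<integral>\<theta>. (1 - h \<theta>) * max 0 (t - G \<theta>) \<partial>m)"
      using bound by (intro \<pi>[of _ "c + \<bar>t\<bar>"]) force+
    also have "(\<integral>\<theta>. h \<theta> * max 0 (t - G \<theta>) \<partial>M) = (\<integral>\<theta>. 0 \<partial>M)"
      by (rule Bochner_Integration.integral_cong) (auto simp: h_def indicator_def)
    also have "(\<integral>\<theta>. (1 - h \<theta>) * max 0 (t - G \<theta>) \<partial>m) = (\<integral>\<theta>. max 0 (t - G \<theta>) \<partial>m)"
      by (rule Bochner_Integration.integral_cong) (auto simp: h_def indicator_def)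
    finally show ?thesis
      by (simp add: dual_objective_def)
  qed
  ultimately show ?thesis by (rule that)
qed

text \<open>Both positive parts are 1-Lipschitz in the multiplier, and \<open>M\<close> and
  \<open>m\<close> have mass one. This continuity is what allows the dual infimum to be taken over
  rational multipliers.\<close>

lemma dual_objective_lipschitz:
  fixes G :: "'th \<Rightarrow> real"
  assumes G [measurable]: "G \<in> borel_measurable A"
    and bound: "\<And>\<theta>. \<theta> \<in> space A \<Longrightarrow> \<bar>G \<theta>\<bar> \<le> c"
  shows "\<bar>dual_objective k K m M G s - dual_objective k K m M G t\<bar> \<le> (1 + K + k) * \<bar>s - t\<bar>"
proof -
  have int: "integrable N (\<lambda>\<theta>. max 0 (G \<theta> - r))" "integrable N (\<lambda>\<theta>. max 0 (r - G \<theta>))"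
    if "finite_measure N" and [measurable_cong]: "sets N = sets A" for N r
  proof -
    have "space N = space A" using that(2) by (rule sets_eq_imp_space_eq)
    then have "\<bar>G \<theta>\<bar> \<le> c" if "\<theta> \<in> space N" for \<theta> using bound that by simp
    then show "integrable N (\<lambda>\<theta>. max 0 (G \<theta> - r))" "integrable N (\<lambda>\<theta>. max 0 (r - G \<theta>))"
      by (intro integrable_bounded_on_space[where c = "c + \<bar>r\<bar>"] that(1); force)+
  qed
  note intM = int[OF M.finite_measure_axioms sets_M] and intm = int[OF m.finite_measure_axioms sets_m]
  have "\<bar>(\<integral>\<theta>. max 0 (G \<theta> - s) \<partial>M) - (\<integral>\<theta>. max 0 (G \<theta> - t) \<partial>M)\<bar> \<le> (\<integral>\<theta>. \<bar>s - t\<bar> \<partial>M)"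
    unfolding Bochner_Integration.integral_diff[OF intM(1) intM(1), symmetric]
    by (intro order_trans[OF integral_abs_bound] integral_mono) (auto intro!: intM Bochner_Integration.integrable_diff integrable_abs)
  moreover have "\<bar>(\<integral>\<theta>. max 0 (s - G \<theta>) \<partial>m) - (\<integral>\<theta>. max 0 (t - G \<theta>) \<partial>m)\<bar> \<le> (\<integral>\<theta>. \<bar>s - t\<bar> \<partial>m)"
    unfolding Bochner_Integration.integral_diff[OF intm(2) intm(2), symmetric]
    by (intro order_trans[OF integral_abs_bound] integral_mono) (auto intro!: intm Bochner_Integration.integrable_diff integrable_abs)
  ultimately have
    "K * \<bar>(\<integral>\<theta>. max 0 (G \<theta> - s) \<partial>M) - (\<integral>\<theta>. max 0 (G \<theta> - t) \<partial>M)\<bar> \<le> K * \<bar>s - t\<bar>"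
    "k * \<bar>(\<integral>\<theta>. max 0 (s - G \<theta>) \<partial>m) - (\<integral>\<theta>. max 0 (t - G \<theta>) \<partial>m)\<bar> \<le> k * \<bar>s - t\<bar>"
    using k K M.prob_space m.prob_space by (auto intro: mult_left_mono)
  then have
    "\<bar>K * (\<integral>\<theta>. max 0 (G \<theta> - s) \<partial>M) - K * (\<integral>\<theta>. max 0 (G \<theta> - t) \<partial>M)\<bar> \<le> K * \<bar>s - t\<bar>"
    "\<bar>k * (\<integral>\<theta>. max 0 (s - G \<theta>) \<partial>m) - k * (\<integral>\<theta>. max 0 (t - G \<theta>) \<partial>m)\<bar> \<le> k * \<bar>s - t\<bar>"
    using k K by (simp_all flip: right_diff_distrib add: abs_mult)
  moreover have "s - t \<le> \<bar>s - t\<bar>" "t - s \<le> \<bar>s - t\<bar>" by simp_all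
  ultimately show ?thesis
    unfolding dual_objective_def distrib_right mult_1
    by argo
qed

text \<open>The attained pair gives a multiplier \<open>t\<close> whose dual value is the maximum of
  the primal problem and, by weak duality, a lower bound for all dual values. Since \<open>t\<close>
  may be irrational, it is approximated by rational multipliers.\<close>

lemma V_fun_eq_INF_dual_objective:
  fixes G :: "'th \<Rightarrow> real"
  assumes G: "G \<in> borel_measurable A"
    and bound: "\<And>\<theta>. \<theta> \<in> space A \<Longrightarrow> \<bar>G \<theta>\<bar> \<le> c"
  shows "V_fun A k K m M G = (INF t\<in>\<rat>. dual_objective k K m M G t)"
proof -
  note upper = integral_le_dual_objective[OF _ G bound]
  obtain t \<pi> where \<pi>: "\<pi> \<in> ref_class A k K m M"
    and t: "(\<integral>\<theta>. G \<theta> \<partial>\<pi>) = dual_objective k K m M G t"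
    using dual_objective_attained[OF G bound] by blast
  have "V_fun A k K m M G = dual_objective k K m M G t"
    unfolding V_fun_def
    by (rule cSup_eq_maximum) (use \<pi> t upper[where t = t] in \<open>auto simp: image_iff intro!: bexI[of _ \<pi>]\<close>)
  moreover have "(INF t\<in>\<rat>. dual_objective k K m M G t) = dual_objective k K m M G t"
  proof (rule cInf_eq_non_empty)
    show "dual_objective k K m M G ` \<rat> \<noteq> {}"
      using Rats_0 by blast
    show "dual_objective k K m M G t \<le> x" if "x \<in> dual_objective k K m M G ` \<rat>" for x
      using that upper[OF \<pi>] by (auto simp flip: t)
    fix y assume y: "\<And>x. x \<in> dual_objective k K m M G ` \<rat> \<Longrightarrow> y \<le> x"
    show "y \<le> dual_objective k K m M G t"
    proof (rule field_le_epsilon)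
      fix e :: real assume "0 < e"
      \<comment> \<open>The distance \<open>e / (1 + K + k)\<close> is \<open>e\<close> divided by
        the Lipschitz constant.\<close>
      then obtain q where q: "q \<in> \<rat>" "t < q" "q < t + e / (1 + K + k)"
        using Rats_dense_in_real[of t "t + e / (1 + K + k)"] k K by auto
      have "y \<le> dual_objective k K m M G q"
        using y q by auto
      also have "\<dots> \<le> dual_objective k K m M G t + (1 + K + k) * \<bar>q - t\<bar>"
        using dual_objective_lipschitz[OF G bound, of q t] by simp
      also have "(1 + K + k) * \<bar>q - t\<bar> \<le> e"
        using q k K by (simp add: field_simps)
      finally show "y \<le> dual_objective k K m M G t + e" by simp
    qed
  qed
  ultimately show ?thesis by simp
qed

text \<open>The supremum runs over a possibly uncountable class of weights. Duality replaces it by a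
  countable infimum of functions of \<omega>, each measurable as a parameter integral of a jointly
  measurable function.\<close>

lemma borel_measurable_V_fun:
  fixes G :: "'w \<Rightarrow> 'th \<Rightarrow> real"
  assumes [measurable]: "case_prod G \<in> borel_measurable (\<Omega> \<Otimes>\<^sub>M A)"
    and bound: "\<And>\<omega> \<theta>. \<omega> \<in> space \<Omega> \<Longrightarrow> \<theta> \<in> space A \<Longrightarrow> \<bar>G \<omega> \<theta>\<bar> \<le> c"
  shows "(\<lambda>\<omega>. V_fun A k K m M (G \<omega>)) \<in> borel_measurable \<Omega>"
proof -
  have "(\<lambda>\<omega>. INF t\<in>\<rat>. dual_objective k K m M (G \<omega>) t) \<in> borel_measurable \<Omega>"
    unfolding dual_objective_def by (intro borel_measurable_cINF_real countable_rat) measurable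
  also have "?this \<longleftrightarrow> ?thesis"
    using bound by (intro measurable_cong V_fun_eq_INF_dual_objective[symmetric]) auto
  finally show ?thesis .
qed

end

section \<open>Hoeffding's inequality for two samples\<close>

text \<open>Independence factors the exponential moment, and Hoeffding's lemma bounds each factor.
  The exponential moment is kept as a separate result because the two samples are combined at this
  level, by multiplying their bounds.\<close>

lemma (in indep_interval_bounded_random_variables) nn_integral_exp_centered_sum_le:
  assumes l: "0 < l"
  shows "(\<integral>\<^sup>+x. ennreal (exp (l * ((\<Sum>i\<in>I. X i x) - (\<Sum>i\<in>I. expectation (X i))))) \<partial>M)
    \<le> ennreal (exp (l\<^sup>2 * (\<Sum>i\<in>I. (b i - a i)\<^sup>2) / 8))"
proof -
  have "(\<integral>\<^sup>+x. ennreal (exp (l * ((\<Sum>i\<in>I. X i x) - (\<Sum>i\<in>I. expectation (X i))))) \<partial>M) =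
      (\<integral>\<^sup>+x. (\<Prod>i\<in>I. ennreal (exp (l * (X i x - expectation (X i))))) \<partial>M)"
    by (intro nn_integral_cong)
      (simp add: prod_ennreal fin sum_distrib_left sum_subtractf[symmetric] flip: exp_sum)
  also have "\<dots> = (\<Prod>i\<in>I. \<integral>\<^sup>+x. ennreal (exp (l * (X i x - expectation (X i)))) \<partial>M)"
    by (intro indep_vars_nn_integral fin indep_vars_compose2[OF indep]) auto
  also have "\<dots> \<le> (\<Prod>i\<in>I. ennreal (exp (l\<^sup>2 * (b i - a i)\<^sup>2 / 8)))"
  proof (rule prod_mono_ennreal)
    fix i assume "i \<in> I"
    then interpret interval_bounded_random_variable M "X i" "a i" "b i" ..
    show "(\<integral>\<^sup>+x. ennreal (exp (l * (X i x - expectation (X i)))) \<partial>M)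
        \<le> ennreal (exp (l\<^sup>2 * (b i - a i)\<^sup>2 / 8))"
      using l by (rule Hoeffdings_lemma_nn_integral)
  qed
  also have "\<dots> = ennreal (exp (l\<^sup>2 * (\<Sum>i\<in>I. (b i - a i)\<^sup>2) / 8))"
    by (simp add: prod_ennreal fin sum_distrib_left sum_divide_distrib exp_sum)
  finally show ?thesis .
qed

lemma (in prob_space) indep_var_nn_integral:
  assumes "indep_var borel X borel Y" "\<And>\<omega>. 0 \<le> X \<omega>" "\<And>\<omega>. 0 \<le> Y \<omega>"
  shows "(\<integral>\<^sup>+\<omega>. X \<omega> * Y \<omega> \<partial>M) = (\<integral>\<^sup>+\<omega>. X \<omega> \<partial>M) * (\<integral>\<^sup>+\<omega>. Y \<omega> \<partial>M)"
proof -
  \<comment> \<open>\<open>indep_var\<close> is independence of a family indexed by the booleans;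
    the product formula asks for a constant family of target spaces.\<close>
  have "case_bool borel borel = (\<lambda>_. borel :: ennreal measure)"
    by (auto simp: fun_eq_iff split: bool.split)
  then have "(\<integral>\<^sup>+\<omega>. (\<Prod>i\<in>UNIV. case_bool X Y i \<omega>) \<partial>M) = (\<Prod>i\<in>UNIV. \<integral>\<^sup>+\<omega>. case_bool X Y i \<omega> \<partial>M)"
    using assms by (intro indep_vars_nn_integral) (simp_all add: indep_var_def)
  then show ?thesis by (simp add: UNIV_bool mult.commute)
qed

text \<open>A Chernoff bound for the total: its exponential moment splits into those of the two
  sums, so independence of the sums is enough and the families need not be merged into one.\<close>

lemma (in prob_space) Hoeffding_ineq_two_independent_sums:
  fixes X :: "'i \<Rightarrow> 'a \<Rightarrow> real" and Y :: "'j \<Rightarrow> 'a \<Rightarrow> real"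
  assumes X: "indep_interval_bounded_random_variables M I X a b"
    and Y: "indep_interval_bounded_random_variables M J Y c d"
    and indep: "indep_var borel (\<lambda>x. \<Sum>i\<in>I. X i x) borel (\<lambda>x. \<Sum>j\<in>J. Y j x)"
    and eps: "0 < \<epsilon>"
    and s: "0 < (\<Sum>i\<in>I. (b i - a i)\<^sup>2) + (\<Sum>j\<in>J. (d j - c j)\<^sup>2)" (is "0 < ?s")
  shows "prob {x\<in>space M. (\<Sum>i\<in>I. expectation (X i)) + (\<Sum>j\<in>J. expectation (Y j)) + \<epsilon>
      \<le> (\<Sum>i\<in>I. X i x) + (\<Sum>j\<in>J. Y j x)} \<le> exp (- 2 * \<epsilon>\<^sup>2 / ?s)"
proof -
  interpret X: indep_interval_bounded_random_variables M I X a b by fact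
  interpret Y: indep_interval_bounded_random_variables M J Y c d by fact
  \<comment> \<open>The minimiser of the exponent \<open>- l * \<epsilon> + l^2 * ?s / 8\<close>,
    whose minimum is \<open>- 2 * \<epsilon>^2 / ?s\<close>.\<close>
  define l where "l = 4 * \<epsilon> / ?s"
  have l: "0 < l" using eps s by (simp add: l_def)
  define U where "U x = (\<Sum>i\<in>I. X i x) - (\<Sum>i\<in>I. expectation (X i))" for x
  define W where "W x = (\<Sum>j\<in>J. Y j x) - (\<Sum>j\<in>J. expectation (Y j))" for x
  have [measurable]: "U \<in> borel_measurable M" "W \<in> borel_measurable M"
    unfolding U_def W_def by simp_all
  have "indep_var borel ((\<lambda>u. ennreal (exp (l * (u - (\<Sum>i\<in>I. expectation (X i)))))) \<circ> (\<lambda>x. \<Sum>i\<in>I. X i x))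
      borel ((\<lambda>w. ennreal (exp (l * (w - (\<Sum>j\<in>J. expectation (Y j)))))) \<circ> (\<lambda>x. \<Sum>j\<in>J. Y j x))"
    by (rule indep_var_compose[OF indep]) simp_all
  then have indep': "indep_var borel (\<lambda>x. ennreal (exp (l * U x))) borel (\<lambda>x. ennreal (exp (l * W x)))"
    by (simp add: comp_def U_def W_def)
  have "ennreal (prob {x\<in>space M. \<epsilon> \<le> U x + W x}) = emeasure M {x\<in>space M. \<epsilon> \<le> U x + W x}"
    by (simp add: emeasure_eq_measure)
  also have "\<dots> \<le> ennreal (exp (- l * \<epsilon>)) * (\<integral>\<^sup>+x\<in>space M. exp (l * (U x + W x)) \<partial>M)"
    by (intro Chernoff_ineq_nn_integral_ge l) auto
  also have "(\<integral>\<^sup>+x\<in>space M. exp (l * (U x + W x)) \<partial>M)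
      = (\<integral>\<^sup>+x. ennreal (exp (l * U x)) * ennreal (exp (l * W x)) \<partial>M)"
    by (intro nn_integral_cong) (simp add: distrib_left exp_add ennreal_mult)
  also have "\<dots> = (\<integral>\<^sup>+x. ennreal (exp (l * U x)) \<partial>M) * (\<integral>\<^sup>+x. ennreal (exp (l * W x)) \<partial>M)"
    using indep' by (rule indep_var_nn_integral) auto
  also have "\<dots> \<le> ennreal (exp (l\<^sup>2 * (\<Sum>i\<in>I. (b i - a i)\<^sup>2) / 8)) * ennreal (exp (l\<^sup>2 * (\<Sum>j\<in>J. (d j - c j)\<^sup>2) / 8))"
    unfolding U_def W_def
    by (intro mult_mono X.nn_integral_exp_centered_sum_le Y.nn_integral_exp_centered_sum_le l) auto
  also have "\<dots> = ennreal (exp (l\<^sup>2 * ?s / 8))"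
    by (simp add: distrib_left add_divide_distrib exp_add flip: ennreal_mult)
  finally have "ennreal (prob {x\<in>space M. \<epsilon> \<le> U x + W x}) \<le> ennreal (exp (- l * \<epsilon>)) * ennreal (exp (l\<^sup>2 * ?s / 8))"
    by (simp add: mult_left_mono)
  then have "prob {x\<in>space M. \<epsilon> \<le> U x + W x} \<le> exp (- l * \<epsilon> + l\<^sup>2 * ?s / 8)"
    unfolding exp_add by (subst (asm) ennreal_mult[symmetric]) simp_all
  moreover have "- l * \<epsilon> + l\<^sup>2 * ?s / 8 = - 2 * \<epsilon>\<^sup>2 / ?s"
  proof -
    have "- (4 * \<epsilon> / v) * \<epsilon> + (4 * \<epsilon> / v)\<^sup>2 * v / 8 = - 2 * \<epsilon>\<^sup>2 / v" if "0 < v" for v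
      using that by (simp add: field_simps power2_eq_square)
    then show ?thesis unfolding l_def using s by blast
  qed
  moreover have "{x\<in>space M. \<epsilon> \<le> U x + W x} = {x\<in>space M. (\<Sum>i\<in>I. expectation (X i)) + (\<Sum>j\<in>J. expectation (Y j)) + \<epsilon>
      \<le> (\<Sum>i\<in>I. X i x) + (\<Sum>j\<in>J. Y j x)}"
    by (auto simp: U_def W_def)
  ultimately show ?thesis
    by simp
qed

section \<open>Empirical means of a single bounded function\<close>

lemma integral_empirical:
  fixes f :: "'x::topological_space \<Rightarrow> real"
  assumes [measurable]: "f \<in> borel_measurable borel" and n: "1 \<le> n"
  shows "(\<integral>x. f x \<partial>empirical n z) = (\<Sum>i<n. f (z i)) / real n"
proof -
  \<comment> \<open>The empirical measure is the law of \<open>z\<close> at a uniformly drawn index,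
    so integrals against it are averages over the indices.\<close>
  have "empirical n z = distr (uniform_count_measure {..<n}) borel z"
  proof (rule measure_eqI)
    fix B assume "B \<in> sets (empirical n z)"
    then have B [measurable]: "B \<in> sets borel" by simp
    have "emeasure (empirical n z) B = (\<Sum>i<n. indicator B (z i)) / of_nat n"
      by (simp add: emeasure_empirical)
    also have "(\<Sum>i<n. indicator B (z i) :: ennreal) = of_nat (card {i\<in>{..<n}. z i \<in> B})"
      by (simp add: indicator_def sum.If_cases Int_def)
    also have "\<dots> / of_nat n = emeasure (distr (uniform_count_measure {..<n}) borel z) B"
      using n by (subst emeasure_distr)
        (auto simp: emeasure_uniform_count_measure_if space_uniform_count_measure
          ennreal_of_nat_eq_real_of_nat divide_ennreal vimage_def Int_def conj_commute)
    finally show "emeasure (empirical n z) B = emeasure (distr (uniform_count_measure {..<n}) borel z) B" .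
  qed simp
  then show ?thesis
    by (simp add: integral_distr integral_uniform_count_measure)
qed


text \<open>The summands are \<open>f (ZQ j) / nQ\<close> and \<open>- f (ZP i) / nP\<close>, with
  ranges of width \<open>b / nQ\<close> and \<open>b / nP\<close>. Summing the squared widths over
  both samples gives \<open>b^2 * (1 / nP + 1 / nQ)\<close>.\<close>

lemma (in prob_space) Hoeffding_ineq_two_sample_means:
  fixes f :: "'x::topological_space \<Rightarrow> real"
  assumes f [measurable]: "f \<in> borel_measurable borel"
    and range: "\<And>x x'. \<bar>f x - f x'\<bar> \<le> b"
    and b: "0 < b" and eps: "0 < \<epsilon>" and n: "1 \<le> nP" "1 \<le> nQ"
    and indep_P: "indep_vars (\<lambda>_. borel) ZP {..<nP}"
    and distr_P: "\<And>i. i < nP \<Longrightarrow> distr M borel (ZP i) = P"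
    and indep_Q: "indep_vars (\<lambda>_. borel) ZQ {..<nQ}"
    and distr_Q: "\<And>j. j < nQ \<Longrightarrow> distr M borel (ZQ j) = Q"
    and indep_PQ: "indep_var
          (Pi\<^sub>M {..<nP} (\<lambda>_. borel)) (\<lambda>\<omega>. \<lambda>i\<in>{..<nP}. ZP i \<omega>)
          (Pi\<^sub>M {..<nQ} (\<lambda>_. borel)) (\<lambda>\<omega>. \<lambda>j\<in>{..<nQ}. ZQ j \<omega>)"
  shows "prob {\<omega>\<in>space M. (\<integral>x. f x \<partial>Q) - (\<integral>x. f x \<partial>P) + \<epsilon>
      \<le> (\<Sum>j<nQ. f (ZQ j \<omega>)) / real nQ - (\<Sum>i<nP. f (ZP i \<omega>)) / real nP}
    \<le> exp (- 2 * \<epsilon>\<^sup>2 / (b\<^sup>2 * (1 / real nP + 1 / real nQ)))"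
proof -
  \<comment> \<open>Starting the interval at the infimum gives it length \<open>b\<close>; centring
    it at an arbitrary value of \<open>f\<close> would give \<open>2 * b\<close>.\<close>
  define lo where "lo = Inf (range f)"
  have bdd: "bdd_below (range f)"
  proof (rule bdd_belowI)
    fix y assume "y \<in> range f"
    then obtain x where "y = f x" by blast
    then show "f undefined - b \<le> y" using range[of undefined x] by (simp add: abs_le_iff)
  qed
  have lo: "lo \<le> f x" for x
    unfolding lo_def using bdd by (intro cInf_lower) auto
  have hi: "f x \<le> lo + b" for x
  proof -
    have "f x - b \<le> lo"
      unfolding lo_def
    proof (rule cInf_greatest)
      fix y assume "y \<in> range f"
      then obtain x' where "y = f x'" by blast
      then show "f x - b \<le> y" using range[of x x'] by (simp add: abs_le_iff)
    qed simp
    then show ?thesis by simp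
  qed
  have ZP [measurable]: "ZP i \<in> borel_measurable M" if "i < nP" for i
    using indep_P that by (auto simp: indep_vars_def)
  have ZQ [measurable]: "ZQ j \<in> borel_measurable M" if "j < nQ" for j
    using indep_Q that by (auto simp: indep_vars_def)
  have EP: "expectation (\<lambda>\<omega>. f (ZP i \<omega>)) = (\<integral>x. f x \<partial>P)" if "i < nP" for i
    using integral_distr[of "ZP i" M borel f] ZP[OF that] distr_P[OF that] by simp
  have EQ: "expectation (\<lambda>\<omega>. f (ZQ j \<omega>)) = (\<integral>x. f x \<partial>Q)" if "j < nQ" for j
    using integral_distr[of "ZQ j" M borel f] ZQ[OF that] distr_Q[OF that] by simp
  have X: "indep_interval_bounded_random_variables M {..<nQ} (\<lambda>j \<omega>. f (ZQ j \<omega>) / nQ)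
      (\<lambda>_. lo / nQ) (\<lambda>_. (lo + b) / nQ)"
    using lo hi by unfold_locales
      (auto intro!: indep_vars_compose2[OF indep_Q, of "\<lambda>_ x. f x / nQ"] divide_right_mono)
  \<comment> \<open>The minus sign exchanges the endpoints of the interval.\<close>
  have Y: "indep_interval_bounded_random_variables M {..<nP} (\<lambda>i \<omega>. - f (ZP i \<omega>) / nP)
      (\<lambda>_. - (lo + b) / nP) (\<lambda>_. - lo / nP)"
  proof unfold_locales
    show "indep_vars (\<lambda>_. borel) (\<lambda>i \<omega>. - f (ZP i \<omega>) / nP) {..<nP}"
      by (rule indep_vars_compose2[OF indep_P]) measurable
    show "AE \<omega> in M. - f (ZP i \<omega>) / nP \<in> {- (lo + b) / nP..- lo / nP}" for i
      unfolding atLeastAtMost_iff using lo hi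
      by (intro AE_I2 conjI divide_right_mono) (simp_all del: minus_add_distrib)
  qed simp
  \<comment> \<open>Each sum is a measurable function of one sample vector, so independence of the
    vectors passes to the sums.\<close>
  have "indep_var borel ((\<lambda>z. \<Sum>i<nP. - f (z i) / nP) \<circ> (\<lambda>\<omega>. \<lambda>i\<in>{..<nP}. ZP i \<omega>))
     borel ((\<lambda>z. \<Sum>j<nQ. f (z j) / nQ) \<circ> (\<lambda>\<omega>. \<lambda>j\<in>{..<nQ}. ZQ j \<omega>))"
    by (rule indep_var_compose[OF indep_PQ]) measurable
  also have "(\<lambda>z. \<Sum>i<nP. - f (z i) / nP) \<circ> (\<lambda>\<omega>. \<lambda>i\<in>{..<nP}. ZP i \<omega>) = (\<lambda>\<omega>. \<Sum>i<nP. - f (ZP i \<omega>) / nP)"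
    by (auto simp: fun_eq_iff intro!: sum.cong)
  also have "(\<lambda>z. \<Sum>j<nQ. f (z j) / nQ) \<circ> (\<lambda>\<omega>. \<lambda>j\<in>{..<nQ}. ZQ j \<omega>) = (\<lambda>\<omega>. \<Sum>j<nQ. f (ZQ j \<omega>) / nQ)"
    by (auto simp: fun_eq_iff intro!: sum.cong)
  finally have indep: "indep_var borel (\<lambda>\<omega>. \<Sum>i<nP. - f (ZP i \<omega>) / nP) borel (\<lambda>\<omega>. \<Sum>j<nQ. f (ZQ j \<omega>) / nQ)" .
  have width: "(\<Sum>i<nP. (- lo / nP - - (lo + b) / nP)\<^sup>2) + (\<Sum>j<nQ. ((lo + b) / nQ - lo / nQ)\<^sup>2) =
      b\<^sup>2 * (1 / real nP + 1 / real nQ)"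
    using n by (simp add: field_simps power2_eq_square flip: diff_divide_distrib)
  have means: "(\<Sum>i<nP. expectation (\<lambda>\<omega>. - f (ZP i \<omega>) / nP)) = - (\<integral>x. f x \<partial>P)"
    "(\<Sum>j<nQ. expectation (\<lambda>\<omega>. f (ZQ j \<omega>) / nQ)) = (\<integral>x. f x \<partial>Q)"
    using n by (simp_all add: EP EQ)
  have "0 < b\<^sup>2 * (1 / real nP + 1 / real nQ)"
    using b n by (intro mult_pos_pos add_pos_pos) auto
  from Hoeffding_ineq_two_independent_sums[OF Y X indep eps, unfolded width, OF this]
  show ?thesis
    unfolding means by (simp add: sum_negf algebra_simps sum_divide_distrib)
qed

section \<open>Certification of dominance\<close>

theorem theorem4p3:
  fixes A :: "'th measure"
    and \<phi> :: "'x::polish_space \<Rightarrow> 'th \<Rightarrow> real"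
    and m M :: "'th measure"
    and P Q :: "'x measure"
    and \<Omega> :: "'w measure"
    and ZP ZQ :: "nat \<Rightarrow> 'w \<Rightarrow> 'x"
    and nP nQ :: nat
    and b k K :: real
  assumes phi_meas: "(\<lambda>(x, \<theta>). \<phi> x \<theta>) \<in> borel_measurable (borel \<Otimes>\<^sub>M A)"
    and phi_bounded: "bounded ((\<lambda>(x, \<theta>). \<phi> x \<theta>) ` (UNIV \<times> space A))"
    and range_bound: "\<forall>\<theta>\<in>space A. \<forall>x x'. \<bar>\<phi> x \<theta> - \<phi> x' \<theta>\<bar> \<le> b"
    and m: "m \<in> space (prob_algebra A)"
    and M: "M \<in> space (prob_algebra A)"
    and k: "0 \<le> k" "k < 1"
    and K: "1 \<le> K"
    and kK: "\<forall>B\<in>sets A. k * measure m B \<le> K * measure M B"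
    and P: "P \<in> space (prob_algebra borel)"
    and Q: "Q \<in> space (prob_algebra borel)"
    and Omega: "prob_space \<Omega>"
    and n: "nP \<ge> 1" "nQ \<ge> 1"
    and indep_P: "prob_space.indep_vars \<Omega> (\<lambda>_. borel) ZP {..<nP}"
    and distr_P: "\<forall>i<nP. distr \<Omega> borel (ZP i) = P"
    and indep_Q: "prob_space.indep_vars \<Omega> (\<lambda>_. borel) ZQ {..<nQ}"
    and distr_Q: "\<forall>j<nQ. distr \<Omega> borel (ZQ j) = Q"
    and indep_PQ: "prob_space.indep_var \<Omega>
          (Pi\<^sub>M {..<nP} (\<lambda>_. borel)) (\<lambda>\<omega>. \<lambda>i\<in>{..<nP}. ZP i \<omega>)
          (Pi\<^sub>M {..<nQ} (\<lambda>_. borel)) (\<lambda>\<omega>. \<lambda>j\<in>{..<nQ}. ZQ j \<omega>)"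
  shows "let Vhat = (\<lambda>\<omega>. V_fun A k K m M
              (\<lambda>\<theta>. - Gamma_fun \<phi> (empirical nP (\<lambda>i. ZP i \<omega>)) (empirical nQ (\<lambda>j. ZQ j \<omega>)) \<theta>))
    in Vhat \<in> borel_measurable \<Omega> \<and>
      (\<forall>\<delta>\<in>{0<..<1}. measure \<Omega>
        {\<omega> \<in> space \<Omega>. Vhat \<omega> + eps_bound b k K nP nQ \<delta> \<le> 0 \<and> \<not> rwsd \<phi> A k K m M Q P} \<le> \<delta>)"
proof -
  interpret \<Omega>: prob_space \<Omega> by fact
  interpret P: prob_space P using P by (simp add: space_prob_algebra)
  interpret Q: prob_space Q using Q by (simp add: space_prob_algebra)
  interpret reference_weights A k K m M
    using m M k K kK by unfold_locales auto
  have sets_P [measurable_cong]: "sets P = sets borel" and sets_Q [measurable_cong]: "sets Q = sets borel"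
    using P Q by (simp_all add: space_prob_algebra)
  note [measurable] = phi_meas
  have ZP [measurable]: "ZP i \<in> borel_measurable \<Omega>" if "i < nP" for i
    using indep_P that by (auto simp: \<Omega>.indep_vars_def)
  have ZQ [measurable]: "ZQ j \<in> borel_measurable \<Omega>" if "j < nQ" for j
    using indep_Q that by (auto simp: \<Omega>.indep_vars_def)

  \<comment> \<open>Measurability of the random value\<close>
  obtain c where c: "\<bar>\<phi> x \<theta>\<bar> \<le> c" if "\<theta> \<in> space A" for x \<theta>
    using phi_bounded unfolding bounded_iff by fastforce
  define G where
    "G \<omega> \<theta> = (\<Sum>i<nP. \<phi> (ZP i \<omega>) \<theta>) / nP - (\<Sum>j<nQ. \<phi> (ZQ j \<omega>) \<theta>) / nQ" for \<omega> \<theta>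
  have Gamma_eq: "- Gamma_fun \<phi> (empirical nP (\<lambda>i. ZP i \<omega>)) (empirical nQ (\<lambda>j. ZQ j \<omega>)) \<theta> = G \<omega> \<theta>"
    if "\<theta> \<in> space A" for \<omega> \<theta>
  proof -
    have "(\<lambda>x. \<phi> x \<theta>) \<in> borel_measurable borel" using that by measurable
    then show ?thesis using n by (simp add: Gamma_fun_def G_def integral_empirical)
  qed
  \<comment> \<open>The formula for the integrand is known only on \<open>space A\<close>, which
    suffices because every admissible weight lives there.\<close>
  have V_eq: "V_fun A k K m M
      (\<lambda>\<theta>. - Gamma_fun \<phi> (empirical nP (\<lambda>i. ZP i \<omega>)) (empirical nQ (\<lambda>j. ZQ j \<omega>)) \<theta>)
      = V_fun A k K m M (G \<omega>)" for \<omega>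
    unfolding V_fun_def
  proof (intro arg_cong[where f = Sup] image_cong refl Bochner_Integration.integral_cong)
    fix \<pi> \<theta> assume "\<pi> \<in> ref_class A k K m M" "\<theta> \<in> space \<pi>"
    moreover from this have "space \<pi> = space A"
      by (intro sets_eq_imp_space_eq) (simp add: ref_class_def space_prob_algebra)
    ultimately show "- Gamma_fun \<phi> (empirical nP (\<lambda>i. ZP i \<omega>)) (empirical nQ (\<lambda>j. ZQ j \<omega>)) \<theta> = G \<omega> \<theta>"
      by (simp add: Gamma_eq)
  qed
  have G_meas [measurable]: "case_prod G \<in> borel_measurable (\<Omega> \<Otimes>\<^sub>M A)"
    unfolding G_def case_prod_beta' by measurable
  have mean_bound: "\<bar>(\<Sum>i<n. \<phi> (z i) \<theta>) / real n\<bar> \<le> c" if "1 \<le> n" "\<theta> \<in> space A" for n z \<theta>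
  proof -
    have "\<bar>\<Sum>i<n. \<phi> (z i) \<theta>\<bar> \<le> (\<Sum>i<n. c)"
      using c that by (intro order_trans[OF sum_abs] sum_mono) auto
    then show ?thesis using that by (simp add: field_simps)
  qed
  have G_bound: "\<bar>G \<omega> \<theta>\<bar> \<le> 2 * c" if "\<theta> \<in> space A" for \<omega> \<theta>
    using mean_bound[OF n(1) that, of "\<lambda>i. ZP i \<omega>"] mean_bound[OF n(2) that, of "\<lambda>j. ZQ j \<omega>"]
    unfolding G_def by linarith
  have V_meas: "(\<lambda>\<omega>. V_fun A k K m M (G \<omega>)) \<in> borel_measurable \<Omega>"
    using G_meas G_bound by (rule borel_measurable_V_fun)

  \<comment> \<open>The error probability at a fixed level\<close>
  have "\<Omega>.prob {\<omega> \<in> space \<Omega>. V_fun A k K m M (G \<omega>) + eps_bound b k K nP nQ \<delta> \<le> 0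
      \<and> \<not> rwsd \<phi> A k K m M Q P} \<le> \<delta>" if \<delta>: "0 < \<delta>" "\<delta> < 1" for \<delta>
  \<comment> \<open>Dominance is a deterministic statement about \<open>P\<close> and
    \<open>Q\<close>: if it holds, the event is empty.\<close>
  proof (cases "rwsd \<phi> A k K m M Q P")
    case True
    then show ?thesis using \<delta> by simp
  next
    case False
    then obtain a \<tau> \<pi> where "0 \<le> \<tau>" and \<pi>: "\<pi> \<in> ref_class A k K m M"
      and less: "(\<integral>x. a + \<tau> * (\<integral>\<theta>. \<phi> x \<theta> \<partial>\<pi>) \<partial>Q) < (\<integral>x. a + \<tau> * (\<integral>\<theta>. \<phi> x \<theta> \<partial>\<pi>) \<partial>P)"
      unfolding rwsd_def by (auto simp: not_le)
    have sets_\<pi> [measurable_cong]: "sets \<pi> = sets A" and "prob_space \<pi>"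
      using \<pi> by (simp_all add: ref_class_def space_prob_algebra)
    interpret \<pi>: prob_space \<pi> by fact
    have space_\<pi>: "space \<pi> = space A" using sets_\<pi> by (rule sets_eq_imp_space_eq)
    have int_\<phi>: "integrable \<pi> (\<phi> x)" for x
      using c by (intro integrable_bounded_on_space[where c = c] \<pi>.finite_measure_axioms)
        (auto simp: space_\<pi>)
    \<comment> \<open>The utility of the violating weight, without its affine transformation. It
      does not depend on the samples and inherits the range bound \<open>b\<close>, since \<pi> has
      mass one.\<close>
    define f where "f x = (\<integral>\<theta>. \<phi> x \<theta> \<partial>\<pi>)" for x
    have f_meas [measurable]: "f \<in> borel_measurable borel"
      unfolding f_def by measurable
    have f_range: "\<bar>f x - f x'\<bar> \<le> b" for x x'
    proof -
      have "\<bar>f x - f x'\<bar> = \<bar>\<integral>\<theta>. \<phi> x \<theta> - \<phi> x' \<theta> \<partial>\<pi>\<bar>"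
        using int_\<phi> by (simp add: f_def)
      also have "\<dots> \<le> (\<integral>\<theta>. b \<partial>\<pi>)"
        using range_bound int_\<phi>
        by (intro order_trans[OF integral_abs_bound] integral_mono integrable_abs
            Bochner_Integration.integrable_diff) (auto simp: space_\<pi>)
      also have "\<dots> = b" using \<pi>.prob_space by simp
      finally show ?thesis .
    qed
    have f_bound: "\<bar>f x\<bar> \<le> \<bar>f undefined\<bar> + b" for x
      using f_range[of x undefined] by linarith
    have f_int: "integrable P f" "integrable Q f"
      using f_bound by (auto intro!: integrable_bounded_on_space[where c = "\<bar>f undefined\<bar> + b"]
          P.finite_measure_axioms Q.finite_measure_axioms)
    have "a + \<tau> * (\<integral>x. f x \<partial>Q) < a + \<tau> * (\<integral>x. f x \<partial>P)"
      using less f_int P.prob_space Q.prob_space by (simp flip: f_def)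
    \<comment> \<open>The strict inequality excludes \<open>\<tau> = 0\<close>, so \<tau> can be
      cancelled.\<close>
    then have f_less: "(\<integral>x. f x \<partial>Q) < (\<integral>x. f x \<partial>P)"
      using \<open>0 \<le> \<tau>\<close> by (auto simp: mult_less_cancel_left)
    \<comment> \<open>With \<open>b = 0\<close> the function \<open>f\<close> would be constant and
      could not separate \<open>P\<close> from \<open>Q\<close>. Positivity of \<open>b\<close>
      makes the Hoeffding exponent meaningful.\<close>
    have "b \<noteq> 0"
    proof
      assume "b = 0"
      then have "f = (\<lambda>_. f undefined)"
        using f_range by (auto simp: fun_eq_iff)
      then have "(\<integral>x. f x \<partial>Q) = f undefined" "(\<integral>x. f x \<partial>P) = f undefined"
        using P.prob_space Q.prob_space by (metis Bochner_Integration.lebesgue_integral_const scaleR_one)+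
      then show False using f_less by simp
    qed
    moreover have "0 \<le> b" using f_range[of undefined undefined] by simp
    ultimately have b: "0 < b" by simp
    define L where "L = ln (1 / \<delta>) + (1 - k) * ln (C_const k K)"
    have "1 \<le> C_const k K" using k K by (simp add: C_const_def field_simps)
    \<comment> \<open>As \<open>C_const k K\<close> is at least 1, its logarithm contributes a
      nonnegative amount, which yields \<open>exp (- L) \<le> \<delta>\<close> at the end.\<close>
    then have L: "ln (1 / \<delta>) \<le> L" using k by (simp add: L_def)
    have "0 < ln (1 / \<delta>)" using \<delta> by simp
    with L have L_pos: "0 < L" by linarith
    define \<epsilon> where "\<epsilon> = eps_bound b k K nP nQ \<delta>"
    define r where "r = 1 / real nP + 1 / real nQ"
    have r: "0 < r" using n by (auto simp: r_def intro!: add_pos_pos)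
    have \<epsilon>_eq: "\<epsilon> = b * sqrt (r * L / 2)"
      by (simp add: \<epsilon>_def eps_bound_def r_def L_def)
    have \<epsilon>: "0 < \<epsilon>" using b r L_pos by (simp add: \<epsilon>_eq)
    \<comment> \<open>The radius is calibrated so that the Hoeffding exponent for \<open>f\<close>
      is exactly \<open>- L\<close>.\<close>
    have "2 * \<epsilon>\<^sup>2 / (b\<^sup>2 * r) = L"
      using b r L_pos by (simp add: \<epsilon>_eq power_mult_distrib)
    have integral_G: "(\<integral>\<theta>. G \<omega> \<theta> \<partial>\<pi>) = (\<Sum>i<nP. f (ZP i \<omega>)) / nP - (\<Sum>j<nQ. f (ZQ j \<omega>)) / nQ" for \<omega>
      unfolding G_def f_def using int_\<phi> by (simp add: Bochner_Integration.integral_sum)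
    have le_V: "(\<integral>\<theta>. G \<omega> \<theta> \<partial>\<pi>) \<le> V_fun A k K m M (G \<omega>)" if "\<omega> \<in> space \<Omega>" for \<omega>
    proof -
      have [measurable]: "G \<omega> \<in> borel_measurable A"
        using measurable_Pair2[OF G_meas that] by simp
      show ?thesis
        \<comment> \<open>Weak duality with multiplier 0 supplies the upper bound under which the
          real supremum dominates each of its members.\<close>
        unfolding V_fun_def using \<pi> integral_le_dual_objective[of _ "G \<omega>" "2 * c" 0] G_bound
        by (intro cSUP_upper bdd_aboveI2) auto
    qed
    have "\<Omega>.prob {\<omega> \<in> space \<Omega>. V_fun A k K m M (G \<omega>) + \<epsilon> \<le> 0 \<and> \<not> rwsd \<phi> A k K m M Q P} \<le>
        \<Omega>.prob {\<omega> \<in> space \<Omega>. (\<integral>x. f x \<partial>Q) - (\<integral>x. f x \<partial>P) + \<epsilon>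
          \<le> (\<Sum>j<nQ. f (ZQ j \<omega>)) / real nQ - (\<Sum>i<nP. f (ZP i \<omega>)) / real nP}"
    proof (rule \<Omega>.finite_measure_mono)
      show "{\<omega> \<in> space \<Omega>. V_fun A k K m M (G \<omega>) + \<epsilon> \<le> 0 \<and> \<not> rwsd \<phi> A k K m M Q P}
        \<subseteq> {\<omega> \<in> space \<Omega>. (\<integral>x. f x \<partial>Q) - (\<integral>x. f x \<partial>P) + \<epsilon>
          \<le> (\<Sum>j<nQ. f (ZQ j \<omega>)) / real nQ - (\<Sum>i<nP. f (ZP i \<omega>)) / real nP}"
      proof safe
        \<comment> \<open>On this event the integral of \<open>G \<omega>\<close> against \<pi> is
          at most \<open>- \<epsilon>\<close>, so the empirical mean of \<open>f\<close> under
          \<open>Q\<close> exceeds that under \<open>P\<close> by at least \<epsilon>, while the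
          true difference is negative.\<close>
        fix \<omega> assume "\<omega> \<in> space \<Omega>" "V_fun A k K m M (G \<omega>) + \<epsilon> \<le> 0"
        with le_V[of \<omega>] f_less integral_G[of \<omega>]
        show "(\<integral>x. f x \<partial>Q) - (\<integral>x. f x \<partial>P) + \<epsilon>
          \<le> (\<Sum>j<nQ. f (ZQ j \<omega>)) / real nQ - (\<Sum>i<nP. f (ZP i \<omega>)) / real nP"
          by linarith
      qed
    qed measurable
    also have "\<dots> \<le> exp (- 2 * \<epsilon>\<^sup>2 / (b\<^sup>2 * r))"
      unfolding r_def using distr_P distr_Q
      by (intro \<Omega>.Hoeffding_ineq_two_sample_means[OF f_meas f_range b \<epsilon> n indep_P _ indep_Q _ indep_PQ]) auto
    also have "\<dots> = exp (- L)"
      using \<open>2 * \<epsilon>\<^sup>2 / (b\<^sup>2 * r) = L\<close> by simp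
    also have "\<dots> \<le> exp (- ln (1 / \<delta>))"
      using L by simp
    also have "\<dots> = \<delta>"
      using \<delta> by (simp add: ln_div)
    finally show ?thesis
      by (simp only: \<epsilon>_def)
  qed
  then show ?thesis
    unfolding Let_def V_eq using V_meas by simp
qed

end
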